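(* Let $p$ be an odd prime and consider the trinomial $X^{p+1}-aX-b\in\mathbb{F}_p[X]$ with $a\neq0$. Put $\zeta:=b/a^2$. For $\zeta\neq0$ let $r\in\mathbb{F}_{p^2}$ be a root of $\zeta X^2+(2\zeta+1)X+\zeta$ and let $m$ be the multiplicative order of $r$ in $\mathbb{F}_{p^2}^*$. Then the multiset of degrees of the irreducible factors (with multiplicity) of $X^{p+1}-aX-b$ over $\mathbb{F}_p$ is: (1) $(m,m,\dots,m)$, with $m\ge3$, if $1+4\zeta$ is a non-square in $\mathbb{F}_p$; (2) $(1,1,m,\dots,m)$, with $m\ge3$, if $\zeta\neq0$ and $1+4\zeta$ is a nonzero square in $\mathbb{F}_p$; (3) $(1,p)$ if $\zeta=-1/4$; (4) $(1,1,\dots,1)$ if $\zeta=0$. *)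

theory Defs
  imports
    "Berlekamp_Zassenhaus.Finite_Field"
    "HOL-Algebra.Algebraic_Closure_Type"
    "HOL-Algebra.Multiplicative_Group"
    "HOL-Computational_Algebra.Nth_Powers"
begin

text \<open>
  The prime field \<open>\<F>\<^sub>p\<close> is the type \<^typ>\<open>'p mod_ring\<close> with \<open>p = CARD('p)\<close>; the class
  \<^class>\<open>prime_card\<close> makes \<open>p\<close> prime. Its quadratic extension is taken inside the algebraic closure
  of \<open>\<F>\<^sub>p\<close>, where it is the set of fixed points of the square of the Frobenius map.
\<close>

definition Fp2 :: "('p :: prime_card) mod_ring alg_closure ring" where
  "Fp2 = ring_of_type_algebra \<lparr>carrier := {x. x ^ (CARD('p)\<^sup>2) = x}\<rparr>"

text \<open>
  \<^const>\<open>prime_factorization\<close> collects the normalised prime factors with multiplicity; for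
  polynomials over a field these are the monic irreducible ones, see \<open>prime_iff_monic_irreducible\<close>.
\<close>

definition factor_degrees :: "('a :: field_gcd) poly \<Rightarrow> nat multiset" where
  "factor_degrees f = image_mset Polynomial.degree (prime_factorization f)"

lemma prime_iff_monic_irreducible:
  fixes q :: "('a :: field_gcd) poly"
  shows "Factorial_Ring.prime q \<longleftrightarrow> Factorial_Ring.irreducible q \<and> Polynomial.lead_coeff q = 1"
proof -
  have "normalize q = q \<longleftrightarrow> Polynomial.lead_coeff q = 1" if "q \<noteq> 0"
  proof
    assume "normalize q = q"
    hence "unit_factor q = 1"
      using that unit_factor_normalize by metis
    thus "Polynomial.lead_coeff q = 1"
      using that by (simp add: unit_factor_poly_def one_pCons dvd_field_iff is_unit_unit_factor)
  next
    assume "Polynomial.lead_coeff q = 1"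
    thus "normalize q = q"
      by (simp add: normalize_poly_eq_map_poly)
  qed
  thus ?thesis
    by (auto simp: Factorial_Ring.prime_def prime_elem_iff_irreducible)
qed

lemma card_carrier_Fp2:
  "card (carrier (Fp2 :: 'p :: prime_card mod_ring alg_closure ring)) = CARD('p)\<^sup>2"
proof -
  define n where "n = CARD('p)\<^sup>2"
  have p: "Factorial_Ring.prime CARD('p)"
    by (rule prime_card)
  have "1 < CARD('p)"
    using p by (rule prime_gt_1_nat)
  hence n: "1 < n"
    unfolding n_def by (rule one_less_power) simp_all
  define P :: "'p mod_ring alg_closure poly"
    where "P = Polynomial.monom 1 n - Polynomial.monom 1 1"
  have P: "poly P x = x ^ n - x" for x
    by (simp add: P_def poly_monom)
  have deg: "Polynomial.degree P = n"
    using degree_add_eq_left[of "- Polynomial.monom 1 1" "Polynomial.monom (1 :: 'p mod_ring alg_closure) n"] n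
    by (simp add: P_def Polynomial.degree_monom_eq)
  have P0: "P \<noteq> 0"
    using deg n by auto
  have n0: "of_nat n = (0 :: 'p mod_ring alg_closure)"
    unfolding n_def by (simp add: of_nat_eq_0_iff_char_dvd power2_eq_square)
  have dP: "pderiv P = -1"
    unfolding P_def pderiv_diff pderiv_monom by (simp add: n0)
  obtain A where A: "size A = n" "P = smult (Polynomial.lead_coeff P) (\<Prod>x\<in>#A. [:-x, 1:])"
    using alg_closed_imp_factorization[OF P0] deg by auto
  have *: "x \<in># A \<longleftrightarrow> poly P x = 0" for x
  proof -
    have "poly P x = Polynomial.lead_coeff P * (\<Prod>y\<in>#A. x - y)"
      using arg_cong[OF A(2), of "\<lambda>q. poly q x"] by (simp add: poly_prod_mset)
    moreover have "Polynomial.lead_coeff P \<noteq> 0"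
      using P0 by simp
    ultimately show ?thesis
      by (auto simp: prod_mset_zero_iff)
  qed
  have "count A x = 1" if "x \<in># A" for x
  proof (rule ccontr)
    assume "count A x \<noteq> 1"
    moreover have "count A x \<noteq> 0"
      using that by simp
    ultimately have "2 \<le> count A x"
      by linarith
    hence "{#x, x#} \<subseteq># A"
      by (intro mset_subset_eqI) auto
    then obtain B where B: "A = {#x, x#} + B"
      using subset_mset.le_iff_add by blast
    define Q where "Q = smult (Polynomial.lead_coeff P) (\<Prod>x\<in>#B. [:-x, 1:])"
    have "P = smult (Polynomial.lead_coeff P) ([:-x, 1:] * ([:-x, 1:] * (\<Prod>x\<in>#B. [:-x, 1:])))"
      using A(2) unfolding B by (simp only: image_mset_union image_mset_add_mset image_mset_empty
        prod_mset_Un prod_mset.add_mset prod_mset_empty mult.assoc mult_1_right mult_1_left)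
    also have "\<dots> = [:-x, 1:] * ([:-x, 1:] * Q)"
      by (simp only: Q_def mult_smult_right)
    finally have P_eq: "P = [:-x, 1:] * ([:-x, 1:] * Q)" .
    have "poly (pderiv P) x = 0"
      unfolding P_eq pderiv_mult poly_add poly_mult by simp
    thus False by (simp add: dP)
  qed
  hence "card (set_mset A) = size A"
    by (simp add: size_multiset_overloaded_eq)
  moreover have "set_mset A = carrier Fp2"
    using * by (auto simp: Fp2_def P n_def)
  ultimately show ?thesis
    using A(1) by (simp add: n_def)
qed

lemma field_Fp2: "Ring.field (Fp2 :: 'p :: prime_card mod_ring alg_closure ring)"
proof -
  let ?R = "ring_of_type_algebra :: 'p mod_ring alg_closure ring"
  let ?n = "CARD('p)\<^sup>2"
  let ?K = "{x :: 'p mod_ring alg_closure. x ^ ?n = x}"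
  interpret R: Ring.field ?R
    by (rule field_from_type_algebra)
  have add: "(x + y) ^ ?n = x ^ ?n + y ^ ?n" for x y :: "'p mod_ring alg_closure"
    by (rule freshmans_dream') (simp_all add: prime_card)
  have neg: "- x \<in> ?K" if "x \<in> ?K" for x
  proof -
    have "0 = (x + - x) ^ ?n" by simp
    also have "\<dots> = x + (- x) ^ ?n"
      using that by (simp only: add mem_Collect_eq)
    finally show ?thesis
      by (simp add: eq_neg_iff_add_eq_0 add.commute)
  qed
  have a_inv: "\<ominus>\<^bsub>?R\<^esub> x = - x" for x
    by (rule R.minus_equality) (auto simp: ring_of_type_algebra_def)
  have m_inv: "inv\<^bsub>?R\<^esub> x = inverse x" if "x \<noteq> 0" for x
    using that by (intro R.comm_inv_char) (auto simp: ring_of_type_algebra_def)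
  have "subfield ?K ?R"
  proof (rule R.subfieldI')
    show "subring ?K ?R"
      using neg add
      by (intro R.subringI) (auto simp: a_inv, auto simp: ring_of_type_algebra_def power_mult_distrib)
  next
    fix k assume "k \<in> ?K - {\<zero>\<^bsub>?R\<^esub>}"
    thus "inv\<^bsub>?R\<^esub> k \<in> ?K"
      by (subst m_inv) (auto simp: ring_of_type_algebra_def power_inverse)
  qed
  thus ?thesis
    unfolding Fp2_def by (rule R.subfield_iff(2))
qed

end

theory Submission
  imports Defs "Berlekamp_Zassenhaus.Distinct_Degree_Factorization"
begin

text \<open>
  A root \<open>x\<close> of \<open>X\<^sup>p\<^sup>+\<^sup>1 - a X - b\<close> with \<open>b \<noteq> 0\<close> satisfies \<open>x\<^sup>p = (a x + b) / x\<close>, so Frobenius acts on the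
  roots as a Moebius transformation whose fixed points are the roots \<open>u\<close>, \<open>v\<close> of \<open>X\<^sup>2 - a X - b\<close>.
  If \<open>u \<noteq> v\<close>, the coordinate \<open>(x - u) / (x - v)\<close> turns it into multiplication by \<open>v / u\<close>, which is a
  root of \<open>\<zeta> X\<^sup>2 + (2 \<zeta> + 1) X + \<zeta>\<close>; if \<open>u = v\<close>, the coordinate \<open>1 / (x - u)\<close> turns it into translation
  by \<open>1 / u\<close>. So a root that is not fixed has Frobenius period \<open>m\<close> in the first case and \<open>p\<close> in the
  second, and this period is the degree of the irreducible factor to which the root belongs.
\<close>

section \<open>Irreducible polynomials and their roots in the algebraic closure\<close>

interpretation to_ac: map_poly_inj_idom_hom "to_ac :: 'a :: field \<Rightarrow> 'a alg_closure"
  by unfold_locales auto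

lemma poly_map_to_ac:
  fixes g :: "'a :: field poly"
  shows "poly (map_poly to_ac g) (to_ac x) = to_ac (poly g x)"
  by (rule to_ac.base.poly_map_poly)

lemma poly_map_to_ac_dvd:
  fixes q g :: "'a :: field poly"
  assumes "q dvd g" "poly (map_poly to_ac q) x = 0"
  shows "poly (map_poly to_ac g) x = 0"
  using assms by (auto simp: dvd_def to_ac.hom_mult)

text \<open>If \<open>q\<close> does not divide \<open>g\<close>, the two are coprime, and
  evaluating a Bezout identity at a common root \<open>x\<close> would give 0 = 1. So
  \<open>q\<close> is the minimal polynomial of \<open>x\<close> up to a unit.\<close>

lemma irreducible_dvd_iff_root:
  fixes q g :: "'a :: field_gcd poly"
  assumes "Factorial_Ring.irreducible q" "poly (map_poly to_ac q) x = 0"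
  shows "q dvd g \<longleftrightarrow> poly (map_poly to_ac g) x = 0"
proof
  assume "q dvd g"
  thus "poly (map_poly to_ac g) x = 0"
    using assms(2) by (rule poly_map_to_ac_dvd)
next
  assume g: "poly (map_poly to_ac g) x = 0"
  show "q dvd g"
  proof (rule ccontr)
    assume "\<not> q dvd g"
    hence "Rings.coprime q g"
      using assms(1) by (intro prime_elem_imp_coprime) (simp_all add: prime_elem_iff_irreducible)
    hence "fst (bezout_coefficients q g) * q + snd (bezout_coefficients q g) * g = 1"
      using bezout_coefficients_fst_snd[of q g] by simp
    hence "poly (map_poly to_ac (fst (bezout_coefficients q g) * q
             + snd (bezout_coefficients q g) * g)) x = 1"
      by simp
    thus False
      by (simp add: to_ac.hom_add to_ac.hom_mult assms(2) g)
  qed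
qed

text \<open>Evaluated at \<open>x\<close>, divisibility of X^(p^k) - X by \<open>q\<close> says that
  the k-th Frobenius iterate fixes \<open>x\<close>, that is, \<open>d dvd k\<close>. By
  \<open>degree_divisor\<close>, this divisibility holds for k = \<open>degree q\<close> and for no
  smaller positive k. Hence \<open>d\<close> divides the degree and cannot be smaller than
  it.\<close>

lemma degree_eq_frobenius_period:
  fixes q :: "'p :: prime_card mod_ring poly"
  assumes q: "Factorial_Ring.irreducible q" "poly (map_poly to_ac q) x = 0"
    and d: "d > 0" "\<And>k. x ^ CARD('p) ^ k = x \<longleftrightarrow> d dvd k"
  shows "Polynomial.degree q = d"
proof -
  have *: "q dvd Polynomial.monom 1 1 ^ CARD('p) ^ k - Polynomial.monom 1 1 \<longleftrightarrow> d dvd k" for k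
    unfolding irreducible_dvd_iff_root[OF q] d(2)[symmetric]
    by (simp add: to_ac.hom_power to_ac.hom_minus map_poly_monom poly_monom
        del: to_ac.base.map_poly_hom_monom)
  have "d dvd Polynomial.degree q"
    using degree_divisor(1)[OF q(1) refl] by (simp only: *)
  moreover have "Polynomial.degree q > 0"
    using q(1) by (metis Factorial_Ring.irreducible_def is_unit_iff_degree not_gr_zero)
  ultimately have "d \<le> Polynomial.degree q"
    by (simp add: dvd_imp_le)
  moreover have "\<not> d < Polynomial.degree q"
    using degree_divisor(2)[OF q(1) refl, of d] d(1) * by auto
  ultimately show ?thesis by simp
qed

lemma irreducible_has_root_alg_closure:
  fixes q :: "'a :: field poly"
  assumes "Factorial_Ring.irreducible q"
  obtains x where "poly (map_poly to_ac q) x = 0"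
proof -
  have "Polynomial.degree q > 0"
    using assms by (metis Factorial_Ring.irreducible_def is_unit_iff_degree not_gr_zero)
  hence "Polynomial.degree (map_poly to_ac q) > 0"
    by (simp add: degree_map_poly)
  thus ?thesis
    using that alg_closed_imp_poly_has_root by blast
qed

section \<open>Multisets of factor degrees\<close>

lemma degree_linear_mult:
  fixes h :: "'a :: field_gcd poly"
  assumes "h \<noteq> 0"
  shows "Polynomial.degree ([:-c, 1:] * h) = Suc (Polynomial.degree h)"
  using assms by (subst degree_mult_eq) auto

lemma factor_degrees_linear_mult:
  fixes h :: "'a :: field_gcd poly"
  assumes "h \<noteq> 0"
  shows "factor_degrees ([:-c, 1:] * h) = add_mset 1 (factor_degrees h)"
proof -
  have "Factorial_Ring.prime [:-c, 1:]"
    unfolding prime_iff_monic_irreducible using irreducible_linear_field_poly[of 1 "- c"] by simp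
  hence "prime_factorization [:-c, 1:] = {#[:-c, 1:]#}"
    by (rule prime_factorization_prime)
  moreover have "prime_factorization ([:-c, 1:] * h) = prime_factorization [:-c, 1:] + prime_factorization h"
    using assms by (intro prime_factorization_mult) auto
  ultimately show ?thesis
    by (simp add: factor_degrees_def)
qed

lemma sum_factor_degrees:
  assumes "f \<noteq> 0"
  shows "sum_mset (factor_degrees f) = Polynomial.degree f"
proof -
  have "Polynomial.degree (prod_mset A) = sum_mset (image_mset Polynomial.degree A)"
    if "0 \<notin># A" for A :: "'a poly multiset"
    using that by (induction A) (auto simp: degree_mult_eq prod_mset_zero_iff)
  from this[of "prime_factorization f"] show ?thesis
    using assms by (simp add: factor_degrees_def prod_mset_prime_factorization degree_normalize)
qed

text \<open>Once all degrees equal \<open>d\<close>, only the number of factors is missing;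
  comparing total degrees supplies it, and the division by \<open>d\<close> is exact.\<close>

lemma factor_degrees_eq_replicate:
  assumes f: "f \<noteq> 0" and d: "d > 0"
    and deg: "\<And>q. Factorial_Ring.irreducible q \<Longrightarrow> q dvd f \<Longrightarrow> Polynomial.degree q = d"
  shows "factor_degrees f = replicate_mset (Polynomial.degree f div d) d"
proof -
  have "image_mset Polynomial.degree (prime_factorization f)
      = image_mset (\<lambda>_. d) (prime_factorization f)"
    by (intro image_mset_cong deg) (auto simp: in_prime_factors_iff prime_iff_monic_irreducible)
  hence *: "factor_degrees f = replicate_mset (size (prime_factorization f)) d"
    by (simp add: factor_degrees_def image_mset_const_eq)
  with sum_factor_degrees[OF f] have "Polynomial.degree f = size (prime_factorization f) * d"
    by (simp add: sum_mset_replicate_mset)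
  with * d show ?thesis by simp
qed

text \<open>By the product rule f' = h + (X - c) h', so f'(c) = h(c). This shows that a rational
  root splits off only once.\<close>

lemma simple_root_cofactor:
  fixes h :: "'a :: idom poly"
  assumes "f = [:-c, 1:] * h" "poly (pderiv f) c \<noteq> 0"
  shows "poly h c \<noteq> 0"
  using assms(2) unfolding assms(1) pderiv_mult poly_add poly_mult by (simp add: pderiv_pCons)

section \<open>The order of \<open>r\<close> and the Frobenius action on roots\<close>

text \<open>Carries the group-theoretic order over to powers in the closure. Positivity excludes the
  value 0, which stands for infinite order: cancelling \<open>r\<close> in r^(p^2) = r shows that
  the order divides p^2 - 1 > 0.\<close>

lemma ord_mult_of_Fp2:
  fixes r :: "'p :: prime_card mod_ring alg_closure"
  assumes "r \<in> carrier Fp2" "r \<noteq> 0"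
  shows "r ^ k = 1 \<longleftrightarrow> group.ord (Multiplicative_Group.mult_of Fp2) r dvd k"
    and "group.ord (Multiplicative_Group.mult_of Fp2) r > 0"
proof -
  interpret F: Ring.field "Fp2 :: 'p mod_ring alg_closure ring" by (rule field_Fp2)
  interpret G: Group.group "Multiplicative_Group.mult_of (Fp2 :: 'p mod_ring alg_closure ring)"
    by (rule F.field_mult_group)
  have r: "r \<in> carrier (Multiplicative_Group.mult_of Fp2)"
    using assms by (simp add: Fp2_def ring_of_type_algebra_def)
  have pow: "r [^]\<^bsub>Multiplicative_Group.mult_of Fp2\<^esub> k = r ^ k" for k :: nat
    by (induction k) (simp_all add: Fp2_def ring_of_type_algebra_def nat_pow_def mult.commute)
  show *: "r ^ k = 1 \<longleftrightarrow> group.ord (Multiplicative_Group.mult_of Fp2) r dvd k" for k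
    using G.pow_eq_id[OF r, of k] by (simp add: pow) (simp add: Fp2_def ring_of_type_algebra_def)
  have card: "CARD('p)\<^sup>2 > 1"
    by (rule one_less_power) (use prime_gt_1_nat[OF prime_card[where 'a='p]] in auto)
  have "r * r ^ (CARD('p)\<^sup>2 - 1) = r ^ CARD('p)\<^sup>2"
    using card by (simp add: power_eq_if[of r "CARD('p)\<^sup>2"])
  also have "\<dots> = r * 1"
    using assms by (simp add: Fp2_def)
  finally have "r ^ (CARD('p)\<^sup>2 - 1) = 1"
    using assms(2) by simp
  hence "group.ord (Multiplicative_Group.mult_of Fp2) r dvd CARD('p)\<^sup>2 - 1"
    by (simp add: *)
  thus "group.ord (Multiplicative_Group.mult_of Fp2) r > 0"
    using card by (auto intro!: Nat.gr0I)
qed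

lemma alg_closure_add_power_frobenius:
  fixes x y :: "'p :: prime_card mod_ring alg_closure"
  shows "(x + y) ^ CARD('p) ^ k = x ^ CARD('p) ^ k + y ^ CARD('p) ^ k"
  by (rule freshmans_dream') (simp_all add: prime_card)

lemma to_ac_power_frobenius:
  fixes x :: "'p :: prime_card mod_ring"
  shows "to_ac x ^ CARD('p) ^ k = to_ac x"
  by (induction k) (simp_all add: power_mult fermat_theorem_mod_ring flip: to_ac_power)

text \<open>Raise the equation of \<open>x\<close> to the power p^k: Frobenius is additive and fixes
  the coefficients \<open>to_ac a\<close> and \<open>to_ac b\<close>. The result is the Moebius
  recurrence along the Frobenius orbit, free of division.\<close>

lemma frobenius_orbit_step:
  fixes x :: "'p :: prime_card mod_ring alg_closure" and a b :: "'p mod_ring"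
  assumes "x ^ (CARD('p) + 1) = to_ac a * x + to_ac b"
  shows "x ^ CARD('p) ^ k * x ^ CARD('p) ^ Suc k = to_ac a * x ^ CARD('p) ^ k + to_ac b"
proof -
  have "x ^ CARD('p) ^ k * x ^ CARD('p) ^ Suc k = (x ^ (CARD('p) + 1)) ^ CARD('p) ^ k"
    by (simp add: power_mult_distrib mult.commute flip: power_mult)
  also have "\<dots> = to_ac a * x ^ CARD('p) ^ k + to_ac b"
    by (simp only: assms alg_closure_add_power_frobenius power_mult_distrib to_ac_power_frobenius)
  finally show ?thesis .
qed

section \<open>Periods of Moebius orbits with two fixed points and with one\<close>

lemma moebius_orbit_diagonalisable:
  fixes x :: "nat \<Rightarrow> 'a :: field"
  assumes step: "\<And>k. x k * x (Suc k) = (u + v) * x k - u * v"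
    and uv: "u \<noteq> 0" "v = r * u" "v \<noteq> 0" "u \<noteq> v" and x0: "x 0 \<noteq> u" "x 0 \<noteq> v"
  shows "x k = x 0 \<longleftrightarrow> r ^ k = 1"
proof -
  have nz: "x k \<noteq> 0" for k
    using step[of k] uv by auto
  \<comment> \<open>\<open>(x k - u) / (x k - v) = r ^ k * (x 0 - u) / (x 0 - v)\<close> with denominators cleared\<close>
  have *: "(x k - u) * (x 0 - v) = r ^ k * (x 0 - u) * (x k - v)"
  proof (induction k)
    case (Suc k)
    \<comment> \<open>One step multiplies the distance to \<open>u\<close> by \<open>v / x k\<close>
      and the distance to \<open>v\<close> by \<open>u / x k\<close>, so their quotient gains the
      factor v / u = \<open>r\<close>.\<close>
    have "x k * (x (Suc k) - u) = v * (x k - u)"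
      using step[of k] by (simp add: algebra_simps)
    hence "x k * ((x (Suc k) - u) * (x 0 - v)) = v * ((x k - u) * (x 0 - v))"
      by (simp only: mult.assoc[symmetric])
    also have "\<dots> = r ^ Suc k * (x 0 - u) * (u * (x k - v))"
      unfolding Suc.IH by (simp add: uv(2) mult_ac)
    also have "u * (x k - v) = x k * (x (Suc k) - v)"
      using step[of k] by (simp add: algebra_simps)
    finally have "x k * ((x (Suc k) - u) * (x 0 - v)) = x k * (r ^ Suc k * (x 0 - u) * (x (Suc k) - v))"
      by (simp only: mult_ac)
    thus ?case using nz[of k] by (simp only: mult_cancel_left) simp
  qed simp
  show ?thesis
  proof
    assume "x k = x 0"
    with * have "(r ^ k - 1) * ((x 0 - u) * (x 0 - v)) = 0"
      by (simp add: algebra_simps)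
    thus "r ^ k = 1" using x0 by simp
  next
    assume "r ^ k = 1"
    \<comment> \<open>The coordinate is injective because \<open>u \<noteq> v\<close>: equal
      coordinates force equal points.\<close>
    with * have "(x k - x 0) * (u - v) = 0"
      by (simp add: algebra_simps)
    thus "x k = x 0" using uv by simp
  qed
qed

lemma moebius_orbit_parabolic:
  fixes x :: "nat \<Rightarrow> 'a :: field"
  assumes step: "\<And>k. x k * x (Suc k) = 2 * u * x k - u\<^sup>2"
    and u: "u \<noteq> 0" and x0: "x 0 \<noteq> u"
  shows "x k = x 0 \<longleftrightarrow> (of_nat k :: 'a) = 0"
proof -
  have nz: "x k \<noteq> 0" for k
    using step[of k] u by auto
  \<comment> \<open>\<open>1 / (x k - u) = 1 / (x 0 - u) + k / u\<close> with denominators cleared\<close>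
  have *: "u * (x 0 - x k) = of_nat k * ((x k - u) * (x 0 - u))"
  proof (induction k)
    case (Suc k)
    have "x k * (u * (x 0 - x (Suc k))) = u * (x k * x 0 - x k * x (Suc k))"
      by (simp add: algebra_simps)
    also have "\<dots> = u * (u * (x 0 - x k)) + u * ((x k - u) * (x 0 - u))"
      unfolding step by (simp add: algebra_simps power2_eq_square)
    also have "\<dots> = of_nat (Suc k) * (u * (x k - u) * (x 0 - u))"
      unfolding Suc.IH by (simp add: algebra_simps)
    also have "u * (x k - u) = x k * (x (Suc k) - u)"
      using step[of k] by (simp add: algebra_simps power2_eq_square)
    finally have "x k * (u * (x 0 - x (Suc k))) = x k * (of_nat (Suc k) * ((x (Suc k) - u) * (x 0 - u)))"
      by (simp only: mult_ac)
    thus ?case using nz[of k] by (simp only: mult_cancel_left) simp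
  qed simp
  show ?thesis
    \<comment> \<open>If \<open>x k = x 0\<close>, the identity reads 0 = k (x 0 - u)^2 with
      \<open>x 0 \<noteq> u\<close>; if k vanishes in the field, its left side vanishes with
      \<open>u \<noteq> 0\<close>.\<close>
    using * u x0 by auto
qed

section \<open>The factor degrees of the trinomial\<close>

theorem theorem10p1:
  fixes a b \<zeta> :: "'p :: prime_card mod_ring"
    and r :: "'p mod_ring alg_closure"
    and p m :: nat
    and f :: "'p mod_ring poly"
  assumes p: "p = CARD('p)" "odd p"
    and a: "a \<noteq> 0"
    and f: "f = Polynomial.monom 1 (p + 1) - Polynomial.monom a 1 - [:b:]"
    and \<zeta>: "\<zeta> = b / a\<^sup>2"
    and r: "\<zeta> \<noteq> 0 \<Longrightarrow> r \<in> carrier Fp2 \<and> poly (map_poly to_ac [:\<zeta>, 2 * \<zeta> + 1, \<zeta>:]) r = 0"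
    and m: "\<zeta> \<noteq> 0 \<Longrightarrow> m = group.ord (Multiplicative_Group.mult_of Fp2) r"
  shows "(\<not> is_square (1 + 4 * \<zeta>) \<longrightarrow>
            m \<ge> 3 \<and> factor_degrees f = replicate_mset ((p + 1) div m) m) \<and>
         (\<zeta> \<noteq> 0 \<and> 1 + 4 * \<zeta> \<noteq> 0 \<and> is_square (1 + 4 * \<zeta>) \<longrightarrow>
            m \<ge> 3 \<and> factor_degrees f = {#1, 1#} + replicate_mset ((p - 1) div m) m) \<and>
         (\<zeta> = - 1 / 4 \<longrightarrow> factor_degrees f = {#1, p#}) \<and>
         (\<zeta> = 0 \<longrightarrow> factor_degrees f = replicate_mset (p + 1) 1)"
proof -
  have p1: "p > 1" unfolding p(1) by (rule prime_gt_1_nat[OF prime_card])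
  have char: "(of_nat k :: 'p mod_ring) = 0 \<longleftrightarrow> p dvd k" for k
    by (simp add: of_nat_eq_0_iff_char_dvd p(1))
  have two: "(2 :: 'p mod_ring) \<noteq> 0"
  proof
    assume "(2 :: 'p mod_ring) = 0"
    hence "p dvd 2" using char[of 2] by simp
    hence "p = 2" using p1 dvd_imp_le[of p 2] by simp
    thus False using p(2) by simp
  qed
  have four: "(4 :: 'p mod_ring) \<noteq> 0"
    using no_zero_divisors[OF two two] by simp
  have b: "b = \<zeta> * a\<^sup>2" using a \<zeta> by simp
  have deg: "Polynomial.degree f = p + 1"
  proof -
    have "f = Polynomial.monom 1 (p + 1) + - (Polynomial.monom a 1 + [:b:])"
      by (simp add: f)
    moreover have "Polynomial.degree (Polynomial.monom a 1 + [:b:]) \<le> 1"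
      by (rule degree_add_le) (simp_all add: Polynomial.degree_monom_eq a)
    hence "Polynomial.degree (- (Polynomial.monom a 1 + [:b:])) < p + 1"
      using p1 by (simp only: Polynomial.degree_minus)
    ultimately show ?thesis
      by (simp add: degree_add_eq_left Polynomial.degree_monom_eq)
  qed
  hence f0: "f \<noteq> 0" by auto
  \<comment> \<open>On the prime field x^p = x, so \<open>f\<close> takes the same values there as
    the quadratic X^2 - aX - b, although the polynomials differ.\<close>
  have fpoly: "poly f x = x\<^sup>2 - a * x - b" for x
    by (simp add: f poly_monom p(1) fermat_theorem_mod_ring power2_eq_square)
  \<comment> \<open>The derivative is (p + 1) X^p - a; here p + 1 = 1 in characteristic p, and x^p =
    x on the prime field.\<close>
  have fderiv: "poly (pderiv f) x = x - a" for x
    using char[of p] by (simp add: f pderiv_diff pderiv_monom poly_monom p(1)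
        fermat_theorem_mod_ring pderiv_pCons)
  have froot: "x ^ (CARD('p) + 1) = to_ac a * x + to_ac b"
    if "Factorial_Ring.irreducible q" "q dvd f" "poly (map_poly to_ac q) x = 0" for q x
  proof -
    have "poly (map_poly to_ac f) x = x ^ (p + 1) - to_ac a * x - to_ac b"
      unfolding f by (simp add: to_ac.hom_minus poly_monom to_ac.base.map_poly_pCons_hom)
    thus ?thesis
      using poly_map_to_ac_dvd[OF that(2,3)] by (simp add: p(1) algebra_simps)
  qed

  \<comment> \<open>Shared by the two cases with distinct fixed points: an irreducible factor with a
    root that is not a fixed point has degree \<open>m\<close>.\<close>
  have moving_root: "m \<ge> 3 \<and> (\<forall>q x. Factorial_Ring.irreducible q \<longrightarrow> q dvd f \<longrightarrow>
        poly (map_poly to_ac q) x = 0 \<longrightarrow> x\<^sup>2 - to_ac a * x - to_ac b \<noteq> 0 \<longrightarrow> Polynomial.degree q = m)"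
    if z: "\<zeta> \<noteq> 0" "1 + 4 * \<zeta> \<noteq> 0"
  proof -
    define Z A where "Z = to_ac \<zeta>" and "A = to_ac a"
    have "to_ac (1 + 4 * \<zeta>) \<noteq> 0"
      using z(2) by (simp only: to_ac_eq_0_iff) simp
    hence ZA: "Z \<noteq> 0" "A \<noteq> 0" "1 + 4 * Z \<noteq> 0" "to_ac b = Z * A\<^sup>2"
      using z(1) a by (simp_all add: Z_def A_def b)
    have rr: "r \<in> carrier Fp2" "Z * r\<^sup>2 + (2 * Z + 1) * r + Z = 0"
      using r[OF z(1)] by (auto simp: Z_def to_ac.base.map_poly_pCons_hom algebra_simps power2_eq_square)
    \<comment> \<open>Substituting 0, 1 and -1 for \<open>r\<close> in its equation gives Z = 0, 1 +
      4 Z = 0 and -1 = 0, all impossible. So \<open>r\<close> has neither order 1 nor order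
      2.\<close>
    have r0: "r \<noteq> 0" using rr(2) ZA by auto
    have r1: "r \<noteq> 1" using rr(2) ZA by (auto simp: algebra_simps)
    have rm1: "r \<noteq> -1" using rr(2) by auto
    note ord = ord_mult_of_Fp2[OF rr(1) r0, folded m[OF z(1)]]
    have "m \<noteq> 1" using ord(1)[of 1] r1 by auto
    moreover have "m \<noteq> 2" using ord(1)[of 2] r1 rm1 by (auto simp: power2_eq_1_iff)
    ultimately have m3: "m \<ge> 3" using ord(2) by linarith
    \<comment> \<open>the solution of \<open>u + v = a\<close> and \<open>v / u = r\<close>; the equation for \<open>r\<close> then says \<open>u v = - b\<close>\<close>
    define u v where "u = A / (1 + r)" and "v = r * u"
    have r1': "1 + r \<noteq> 0" using rm1 by (simp add: add_eq_0_iff)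
    have uv: "u \<noteq> 0" "v \<noteq> 0" "u \<noteq> v" using r0 r1 r1' ZA by (simp_all add: u_def v_def)
    have A': "A = u * (1 + r)" using r1' by (simp add: u_def)
    hence A: "A = u + v" by (simp add: v_def algebra_simps)
    have "Z * A\<^sup>2 = (Z * r\<^sup>2 + (2 * Z + 1) * r + Z) * u\<^sup>2 - u * v"
      unfolding A' v_def by (simp add: algebra_simps power2_eq_square)
    hence B: "to_ac b = - (u * v)" using ZA rr(2) by simp
    have "Polynomial.degree q = m"
      if q: "Factorial_Ring.irreducible q" "q dvd f" "poly (map_poly to_ac q) x = 0"
        and x: "x\<^sup>2 - to_ac a * x - to_ac b \<noteq> 0" for q x
    proof (rule degree_eq_frobenius_period[OF q(1,3)])
      show "m > 0" using m3 by simp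
      have "x\<^sup>2 - to_ac a * x - to_ac b = (x - u) * (x - v)"
        unfolding B A_def[symmetric] A by (simp add: algebra_simps power2_eq_square)
      hence xuv: "x \<noteq> u" "x \<noteq> v" using x by auto
      show "x ^ CARD('p) ^ k = x \<longleftrightarrow> m dvd k" for k
        using moebius_orbit_diagonalisable[of "\<lambda>k. x ^ CARD('p) ^ k" u v r k]
          frobenius_orbit_step[OF froot[OF q]] uv xuv v_def
        by (simp add: B A_def[symmetric] A ord(1))
    qed
    with m3 show ?thesis by blast
  qed

  \<comment> \<open>Non-square discriminant: no rational roots\<close>
  have "m \<ge> 3 \<and> factor_degrees f = replicate_mset ((p + 1) div m) m"
    if ns: "\<not> is_square (1 + 4 * \<zeta>)"
  proof -
    have "is_square (1 :: 'p mod_ring)" "is_square (0 :: 'p mod_ring)"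
      by (auto simp: is_nth_power_def intro: exI[of _ 1] exI[of _ 0])
    hence z: "\<zeta> \<noteq> 0" "1 + 4 * \<zeta> \<noteq> 0" using ns by auto
    have noroot: "poly f c \<noteq> 0" for c
    proof
      assume "poly f c = 0"
      \<comment> \<open>Completing the square: the quadratic has discriminant a^2 + 4 b = a^2 (1 + 4
        \<zeta>), which a rational root would make a square.\<close>
      moreover have "(2 * c - a)\<^sup>2 = a\<^sup>2 * (1 + 4 * \<zeta>) + 4 * poly f c"
        unfolding fpoly b by (simp add: algebra_simps power2_eq_square)
      ultimately have "(2 * c - a)\<^sup>2 = a\<^sup>2 * (1 + 4 * \<zeta>)" by simp
      hence "1 + 4 * \<zeta> = ((2 * c - a) / a)\<^sup>2" using a by (simp add: power_divide)
      thus False using ns by (auto simp: is_nth_power_def)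
    qed
    have "Polynomial.degree q = m" if q: "Factorial_Ring.irreducible q" "q dvd f" for q
    proof -
      obtain x where x: "poly (map_poly to_ac q) x = 0"
        using irreducible_has_root_alg_closure[OF q(1)] .
      have "x\<^sup>2 - to_ac a * x - to_ac b \<noteq> 0"
      \<comment> \<open>A fixed root satisfies x^2 = a x + b = x^(p+1), hence x^p = x. Its factor is
        then linear and yields a root of \<open>f\<close> in the prime field, contrary to
        \<open>noroot\<close>.\<close>
      proof
        assume 0: "x\<^sup>2 - to_ac a * x - to_ac b = 0"
        have x0: "x \<noteq> 0" using 0 z a by (auto simp: b)
        have "x * x ^ CARD('p) = x * x"
          using froot[OF q x] 0 by (simp add: power2_eq_square algebra_simps)
        hence xp: "x ^ CARD('p) = x" using x0 by simp
        have "x ^ CARD('p) ^ k = x" for k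
          by (induction k) (simp_all add: power_mult xp)
        hence "Polynomial.degree q = 1"
          by (intro degree_eq_frobenius_period[OF q(1) x]) auto
        then obtain c d where "q = [:c, d:]" "d \<noteq> 0"
          by (rule degree1_coeffs)
        hence "poly q (- c / d) = 0" by simp
        thus False using noroot[of "- c / d"] q(2) by (auto simp: dvd_def)
      qed
      with moving_root[OF z] q x show ?thesis by blast
    qed
    hence "factor_degrees f = replicate_mset (Polynomial.degree f div m) m"
      using moving_root[OF z] by (intro factor_degrees_eq_replicate f0) auto
    thus ?thesis using moving_root[OF z] deg by simp
  qed

  \<comment> \<open>Nonzero square discriminant: two rational roots\<close>
  moreover have "m \<ge> 3 \<and> factor_degrees f = {#1, 1#} + replicate_mset ((p - 1) div m) m"
    if z: "\<zeta> \<noteq> 0" "1 + 4 * \<zeta> \<noteq> 0" and sq: "is_square (1 + 4 * \<zeta>)"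
  proof -
    obtain w where w: "1 + 4 * \<zeta> = w\<^sup>2" using sq by (auto simp: is_nth_power_def)
    \<comment> \<open>The quadratic formula for X^2 - aX - b, whose discriminant has the square root
      \<open>a * w\<close>.\<close>
    define U V where "U = (a + a * w) / 2" and "V = (a - a * w) / 2"
    have U2: "2 * U = a + a * w" and V2: "2 * V = a - a * w"
      using two by (simp_all add: U_def V_def)
    have UV: "U + V = a" using U2 V2 two by (simp add: U_def V_def flip: add_divide_distrib)
    have "4 * (U * V) = (2 * U) * (2 * V)" by simp
    also have "\<dots> = a\<^sup>2 * (1 - w\<^sup>2)" unfolding U2 V2 by (simp add: algebra_simps power2_eq_square)
    also have "\<dots> = 4 * (-b)" unfolding w[symmetric] b by (simp add: algebra_simps)
    finally have "U * V = - b" using mult_left_cancel[OF four] by blast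
    hence UVb: "b = - (U * V)" by simp
    have w0: "w \<noteq> 0" using w z by auto
    have "U \<noteq> V"
    proof
      assume "U = V"
      hence "2 * (a * w) = 0" using U2 V2 by (simp add: algebra_simps)
      thus False using a w0 two by simp
    qed
    have U0: "U \<noteq> 0" "V \<noteq> 0" using UVb z b a by auto
    have fUV: "poly f x = (x - U) * (x - V)" for x
      unfolding fpoly UVb UV[symmetric] by (simp add: algebra_simps power2_eq_square)
    obtain h where h: "f = [:-U, 1:] * h"
      using fUV[of U] by (auto simp: poly_eq_0_iff_dvd)
    have "poly f V = (V - U) * poly h V" unfolding h poly_mult by simp
    hence "poly h V = 0" using fUV[of V] \<open>U \<noteq> V\<close> by simp
    then obtain g where g: "h = [:-V, 1:] * g" by (auto simp: poly_eq_0_iff_dvd)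
    have fU: "f = [:-U, 1:] * ([:-V, 1:] * g)" and fV: "f = [:-V, 1:] * ([:-U, 1:] * g)"
      unfolding h g by (simp_all only: mult_ac)
    \<comment> \<open>The derivative of \<open>f\<close> at \<open>U\<close> is U - a = -V, and at
      \<open>V\<close> it is -U. Both are nonzero, so \<open>U\<close> and \<open>V\<close> are
      simple roots and do not recur in \<open>g\<close>; every root of \<open>g\<close> is therefore
      moved by Frobenius.\<close>
    have gU: "poly g U \<noteq> 0"
      using simple_root_cofactor[OF fU] fderiv[of U] U0 UV[symmetric] by simp
    have gV: "poly g V \<noteq> 0"
      using simple_root_cofactor[OF fV] fderiv[of V] U0 UV[symmetric] by simp
    have g0: "g \<noteq> 0" using gU by auto
    have h0: "h \<noteq> 0" using f0 h by auto
    have "p + 1 = 2 + Polynomial.degree g"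
      using degree_linear_mult[OF h0, of U] degree_linear_mult[OF g0, of V] deg
      unfolding h[symmetric] g[symmetric] by simp
    hence degg: "Polynomial.degree g = p - 1" by simp
    have "Polynomial.degree q = m" if q: "Factorial_Ring.irreducible q" "q dvd g" for q
    proof -
      obtain x where x: "poly (map_poly to_ac q) x = 0"
        using irreducible_has_root_alg_closure[OF q(1)] .
      have gx: "poly (map_poly to_ac g) x = 0"
        using poly_map_to_ac_dvd[OF q(2) x] .
      have "x \<noteq> to_ac U" "x \<noteq> to_ac V"
        using gx gU gV by (auto simp: poly_map_to_ac)
      hence "(x - to_ac U) * (x - to_ac V) \<noteq> 0" by simp
      also have "(x - to_ac U) * (x - to_ac V) = x\<^sup>2 - to_ac a * x - to_ac b"
        unfolding UVb UV[symmetric] by (simp add: algebra_simps power2_eq_square)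
      finally have "x\<^sup>2 - to_ac a * x - to_ac b \<noteq> 0" .
      moreover have "q dvd f" using q(2) unfolding fU by (intro dvd_mult)
      ultimately show ?thesis using moving_root[OF z] q(1) x by blast
    qed
    hence "factor_degrees g = replicate_mset ((p - 1) div m) m"
      unfolding degg[symmetric] using moving_root[OF z] by (intro factor_degrees_eq_replicate g0) auto
    moreover have "factor_degrees f = {#1, 1#} + factor_degrees g"
      using factor_degrees_linear_mult[OF h0, of U] factor_degrees_linear_mult[OF g0, of V]
      unfolding h[symmetric] g[symmetric] by simp
    ultimately show ?thesis using moving_root[OF z] by simp
  qed

  \<comment> \<open>Zero discriminant: one rational root\<close>
  moreover have "factor_degrees f = {#1, p#}" if z: "\<zeta> = - 1 / 4"
  proof -
    define u where "u = a / 2"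
    have u0: "u \<noteq> 0" and au: "a = 2 * u" using a two by (simp_all add: u_def)
    have "4 * b = - (a\<^sup>2)" unfolding b z using four by simp
    hence "4 * b = 4 * - (u\<^sup>2)" unfolding au by (simp add: power2_eq_square)
    hence bu: "b = - (u\<^sup>2)" using mult_left_cancel[OF four] by blast
    have "poly f u = 0" unfolding fpoly au bu by (simp add: power2_eq_square)
    then obtain g where fg: "f = [:-u, 1:] * g" by (auto simp: poly_eq_0_iff_dvd)
    \<comment> \<open>Although \<open>u\<close> is a double root of the quadratic, it is a simple
      root of \<open>f\<close>: the derivative there is u - a = -u, which is nonzero.\<close>
    have gu: "poly g u \<noteq> 0"
      using simple_root_cofactor[OF fg] fderiv[of u] u0 au by simp
    hence g0: "g \<noteq> 0" by auto
    have "p + 1 = 1 + Polynomial.degree g"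
      using degree_linear_mult[OF g0, of u] deg unfolding fg[symmetric] by simp
    hence degg: "Polynomial.degree g = p" by simp
    have "Polynomial.degree q = p" if q: "Factorial_Ring.irreducible q" "q dvd g" for q
    proof -
      obtain x where x: "poly (map_poly to_ac q) x = 0"
        using irreducible_has_root_alg_closure[OF q(1)] .
      have qf: "q dvd f" using q(2) unfolding fg by (intro dvd_mult)
      have xu: "x \<noteq> to_ac u"
        using poly_map_to_ac_dvd[OF q(2) x] gu by (auto simp: poly_map_to_ac)
      show ?thesis
      proof (rule degree_eq_frobenius_period[OF q(1) x])
        show "p > 0" using p1 by simp
        \<comment> \<open>The translation returns to its start after k steps exactly when k vanishes
          in characteristic p.\<close>
        show "x ^ CARD('p) ^ k = x \<longleftrightarrow> p dvd k" for k
          using moebius_orbit_parabolic[of "\<lambda>k. x ^ CARD('p) ^ k" "to_ac u" k]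
            frobenius_orbit_step[OF froot[OF q(1) qf x]] u0 xu
          by (simp add: au bu of_nat_eq_0_iff_char_dvd p(1))
      qed
    qed
    hence "factor_degrees g = replicate_mset (Polynomial.degree g div p) p"
      using p1 by (intro factor_degrees_eq_replicate g0) auto
    moreover have "factor_degrees f = {#1#} + factor_degrees g"
      using factor_degrees_linear_mult[OF g0, of u] unfolding fg[symmetric] by simp
    ultimately show ?thesis using degg p1 by simp
  qed

  \<comment> \<open>The degenerate case b = 0\<close>
  moreover have "factor_degrees f = replicate_mset (p + 1) 1" if z: "\<zeta> = 0"
  proof -
    have "Polynomial.degree q = 1" if q: "Factorial_Ring.irreducible q" "q dvd f" for q
    proof -
      obtain x where x: "poly (map_poly to_ac q) x = 0"
        using irreducible_has_root_alg_closure[OF q(1)] .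
      \<comment> \<open>Here f = X (X^p - a) = X (X - a)^p, since a = a^p and Frobenius is additive.
        Its roots 0 and a are rational, so their Frobenius period is 1.\<close>
      have "x * x ^ CARD('p) = to_ac a * x"
        using froot[OF q x] by (simp add: b z)
      hence "x = 0 \<or> x ^ CARD('p) = to_ac a ^ CARD('p)"
        using to_ac_power_frobenius[of a 1] by (auto simp: mult.commute)
      hence "x = 0 \<or> (x - to_ac a) ^ CARD('p) = 0"
        using alg_closure_add_power_frobenius[of "x - to_ac a" "to_ac a" 1] by auto
      hence "x = to_ac 0 \<or> x = to_ac a" by auto
      hence "x ^ CARD('p) ^ k = x" for k
        using to_ac_power_frobenius by metis
      thus ?thesis
        by (intro degree_eq_frobenius_period[OF q(1) x]) auto
    qed
    hence "factor_degrees f = replicate_mset (Polynomial.degree f div 1) 1"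
      by (intro factor_degrees_eq_replicate f0) auto
    thus ?thesis using deg by simp
  qed

  ultimately show ?thesis by blast
qed

end
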